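(* Let $m$ be a positive integer, and let $\Phi=\{\phi_i(x)=\rho x+b_i\}_{i=0}^m$ be maps on $\mathbb{R}$ with $0<\rho<1$ and $0=b_0<b_1<\cdots<b_m=1-\rho$. Assume in addition that $b_{i+1}-b_i\leq\rho$ for all $0\leq i\leq m-1$. If $\Phi$ satisfies the weak separation condition, then $\Phi$ also satisfies the finite type condition.
   Context: For a finite word $I=i_1\ldots i_n\in\{0,1,\ldots,m\}^n$ write $\phi_I=\phi_{i_1}\circ\cdots\circ\phi_{i_n}$, so $\phi_I(0)=b_{i_1}+\rho b_{i_2}+\cdots+\rho^{n-1}b_{i_n}$. $\Phi$ satisfies the weak separation condition if there is a constant $c>0$ such that for every $n\in\mathbb{N}$ and all $I,J\in\{0,\ldots,m\}^n$, either $\rho^{-n}|\phi_I(0)-\phi_J(0)|=0$ or $\rho^{-n}|\phi_I(0)-\phi_J(0)|\geq c$. $\Phi$ satisfies the finite type condition if there is a finite set $\Gamma\subset[0,1)$ such that for every $n\in\mathbb{N}$ and all $I,J\in\{0,\ldots,m\}^n$, either $\rho^{-n}|\phi_I(0)-\phi_J(0)|\geq 1$ or $\rho^{-n}|\phi_I(0)-\phi_J(0)|\in\Gamma$. *)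

theory Defs
  imports Complex_Main
begin

text \<open>
  A family of maps \<open>\<phi> 0, \<dots>, \<phi> m\<close> on the reals is given as \<open>\<phi> :: nat \<Rightarrow> real \<Rightarrow> real\<close>, of which
  only the values at indices \<open>\<le> m\<close> matter. A word \<open>i\<^sub>1 \<dots> i\<^sub>n\<close> is the list \<open>[i\<^sub>1, \<dots>, i\<^sub>n]\<close>; its
  map is \<open>\<phi> i\<^sub>1 \<circ> \<dots> \<circ> \<phi> i\<^sub>n\<close>, so the last letter acts first.
\<close>

definition words :: "nat \<Rightarrow> nat \<Rightarrow> nat list set" where
  "words m n = {I. length I = n \<and> set I \<subseteq> {0..m}}"

definition word_map :: "(nat \<Rightarrow> real \<Rightarrow> real) \<Rightarrow> nat list \<Rightarrow> real \<Rightarrow> real" where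
  "word_map \<phi> I = foldr (\<lambda>i f. \<phi> i \<circ> f) I id"

lemma word_map_0:
  assumes "\<And>i x. i \<le> m \<Longrightarrow> \<phi> i x = \<rho> * x + b i" and "I \<in> words m n"
  shows "word_map \<phi> I 0 = (\<Sum>k<n. \<rho> ^ k * b (I ! k))"
  using assms(2)
proof (induction I arbitrary: n)
  case Nil
  then show ?case by (simp add: words_def word_map_def)
next
  case (Cons i I)
  then have "i \<le> m" "I \<in> words m (length I)" "n = Suc (length I)"
    by (auto simp: words_def)
  with Cons.IH[of "length I"] assms(1) show ?case
    by (simp add: word_map_def sum.lessThan_Suc_shift sum_distrib_left mult.assoc
          del: sum.lessThan_Suc)
qed

text \<open>
  In the next two definitions \<open>\<rho>\<close> is the common contraction ratio of the maps. The empty word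
  (\<open>n = 0\<close>) only contributes the difference \<open>0\<close>, which the words with \<open>I = J\<close> of positive
  length contribute as well.
\<close>

definition weak_separation_condition :: "nat \<Rightarrow> real \<Rightarrow> (nat \<Rightarrow> real \<Rightarrow> real) \<Rightarrow> bool" where
  "weak_separation_condition m \<rho> \<phi> \<longleftrightarrow>
     (\<exists>c>0. \<forall>n. \<forall>I\<in>words m n. \<forall>J\<in>words m n.
        \<bar>word_map \<phi> I 0 - word_map \<phi> J 0\<bar> / \<rho> ^ n = 0 \<or>
        \<bar>word_map \<phi> I 0 - word_map \<phi> J 0\<bar> / \<rho> ^ n \<ge> c)"

definition finite_type_condition :: "nat \<Rightarrow> real \<Rightarrow> (nat \<Rightarrow> real \<Rightarrow> real) \<Rightarrow> bool" where
  "finite_type_condition m \<rho> \<phi> \<longleftrightarrow>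
     (\<exists>\<Gamma>. finite \<Gamma> \<and> \<Gamma> \<subseteq> {0..<1} \<and>
        (\<forall>n. \<forall>I\<in>words m n. \<forall>J\<in>words m n.
           \<bar>word_map \<phi> I 0 - word_map \<phi> J 0\<bar> / \<rho> ^ n \<ge> 1 \<or>
           \<bar>word_map \<phi> I 0 - word_map \<phi> J 0\<bar> / \<rho> ^ n \<in> \<Gamma>))"

end

theory Submission
  imports Defs
begin

text \<open>
  Let \<open>X n\<close> be the set of the numbers \<open>\<rho>\<^sup>-\<^sup>n \<phi>\<^sub>I(0)\<close> with \<open>|I| = n\<close>. The condition on the gaps of \<open>b\<close> says
  that the intervals \<open>[x, x + 1)\<close> with \<open>x \<in> X n\<close> cover \<open>[0, \<rho>\<^sup>-\<^sup>n)\<close>. By weak separation, the number of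
  these intervals that contain a given point is bounded; let the maximum be attained at level \<open>N\<close>
  and at the point \<open>s\<close>. Since \<open>\<rho>\<^sup>-\<^sup>N v + X N \<subseteq> X (j + N)\<close> for \<open>v \<in> X j\<close>, maximality forces all
  intervals of level \<open>j + N\<close> around \<open>\<rho>\<^sup>-\<^sup>N v + s\<close> to be translates of those around \<open>s\<close>.

  Given \<open>x, y \<in> X l\<close> with \<open>0 \<le> y - x \<le> 1 - \<rho>\<^sup>j\<close>, place this configuration at the rightmost descendant
  of \<open>x\<close>, where descendants of \<open>y\<close> are also present. They then coincide with descendants of \<open>x\<close>, which
  leaves finitely many values for \<open>y - x\<close>. Finally, a difference close to \<open>1\<close> arises either from one
  of these finitely many values or from a parent difference that is even closer to \<open>1\<close>, so the
  differences below \<open>1\<close> stay away from \<open>1\<close>.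
\<close>

section \<open>Finite and separated sets of reals\<close>

lemma finite_positive_lower_bound:
  fixes S :: "real set"
  assumes "finite S"
  shows "\<exists>\<delta>>0. \<forall>s\<in>S. 0 < s \<longrightarrow> \<delta> \<le> s"
proof (intro exI[of _ "Min (insert 1 {s \<in> S. 0 < s})"] conjI)
  show "0 < Min (insert 1 {s \<in> S. 0 < s})"
    using assms by (subst Min_gr_iff) auto
  show "\<forall>s\<in>S. 0 < s \<longrightarrow> Min (insert 1 {s \<in> S. 0 < s}) \<le> s"
    using assms by auto
qed

text \<open>Cut the line into cells of length \<open>c\<close>, counted downwards from
  \<open>t\<close>. Two points in one cell are less than \<open>c\<close> apart, so the cell number
  is injective on \<open>A\<close>.\<close>

lemma card_separated_le:
  fixes A :: "real set"
  assumes "c > 0" and "A \<subseteq> {t - 1..t}"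
    and sep: "\<And>x y. x \<in> A \<Longrightarrow> y \<in> A \<Longrightarrow> x \<noteq> y \<Longrightarrow> c \<le> \<bar>x - y\<bar>"
  shows "card A \<le> Suc (nat \<lfloor>1 / c\<rfloor>)"
proof -
  let ?f = "\<lambda>x. \<lfloor>(t - x) / c\<rfloor>"
  have "inj_on ?f A"
  proof (rule inj_onI)
    fix x y assume xy: "x \<in> A" "y \<in> A" and eq: "?f x = ?f y"
    have "\<bar>(t - x) / c - (t - y) / c\<bar> < 1"
      using eq by linarith
    moreover have "(t - x) / c - (t - y) / c = (y - x) / c"
      by (simp add: diff_divide_distrib)
    ultimately have "\<bar>x - y\<bar> < c"
      using \<open>c > 0\<close> by (simp add: abs_divide abs_minus_commute)
    then show "x = y"
      using sep[OF xy] by force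
  qed
  moreover have "?f ` A \<subseteq> {0..\<lfloor>1 / c\<rfloor>}"
    using assms(1,2) by (force intro!: floor_mono divide_right_mono)
  ultimately have "card A \<le> card {0..\<lfloor>1 / c\<rfloor>}"
    by (intro card_inj_on_le) auto
  then show ?thesis
    using \<open>c > 0\<close> by (simp add: nat_add_distrib)
qed

section \<open>Scaled level sets and their cover by unit intervals\<close>

locale covering_digits =
  fixes m :: nat and \<rho> :: real and b :: "nat \<Rightarrow> real"
  assumes rho_pos: "0 < \<rho>" and rho_less_1: "\<rho> < 1"
    and b_0: "b 0 = 0" and b_m: "b m = 1 - \<rho>"
    and b_less: "\<And>i. i < m \<Longrightarrow> b i < b (Suc i)"
    and b_gap: "\<And>i. i < m \<Longrightarrow> b (Suc i) - b i \<le> \<rho>"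
begin

text \<open>The recursion appends a letter at the end of the word, so each element has a parent one
  level up.\<close>

fun X :: "nat \<Rightarrow> real set" where
  "X 0 = {0}"
| "X (Suc n) = (\<lambda>(x, i). (x + b i) / \<rho>) ` (X n \<times> {..m})"

lemma X_SucI: "x \<in> X n \<Longrightarrow> i \<le> m \<Longrightarrow> (x + b i) / \<rho> \<in> X (Suc n)"
  by force

lemma X_SucE:
  assumes "y \<in> X (Suc n)"
  obtains x i where "x \<in> X n" "i \<le> m" "y = (x + b i) / \<rho>"
  using assms by force

lemma finite_X: "finite (X n)"
  by (induction n) auto

lemma b_bounds:
  assumes "i \<le> m" shows "0 \<le> b i" "b i \<le> 1 - \<rho>"
proof -
  have mono: "b i \<le> b j" if "i \<le> j" "j \<le> m" for i j
    using that
  proof (induction j rule: dec_induct)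
    case (step k)
    then show ?case using b_less[of k] by simp
  qed simp
  show "0 \<le> b i" "b i \<le> 1 - \<rho>"
    using mono[of 0 i] mono[of i m] assms b_0 b_m by auto
qed

lemma digit_cover:
  assumes "0 \<le> r" "r < 1"
  shows "\<exists>i\<le>m. b i \<le> r \<and> r < b i + \<rho>"
proof -
  \<comment> \<open>Scan from the left: if \<open>r\<close> lies beyond the \<open>k\<close>-th
    interval, the gap condition gives \<open>b (Suc k) \<le> r\<close>. At \<open>k = m\<close> this
    alternative is void, since \<open>b m + \<rho> = 1\<close>.\<close>
  have "(\<exists>i\<le>k. b i \<le> r \<and> r < b i + \<rho>) \<or> b k + \<rho> \<le> r" if "k \<le> m" for k
    using that
  proof (induction k)
    case 0
    then show ?case using assms b_0 by force
  next
    case (Suc k)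
    then show ?case using b_gap[of k] by (force simp: le_Suc_eq)
  qed
  from this[of m] show ?thesis using assms b_m by auto
qed

lemma X_bounds:
  assumes "x \<in> X n" shows "0 \<le> x" "x + 1 \<le> 1 / \<rho> ^ n"
proof -
  have "0 \<le> x \<and> x + 1 \<le> 1 / \<rho> ^ n"
    using assms
  proof (induction n arbitrary: x)
    case (Suc n)
    obtain y i where y: "y \<in> X n" "i \<le> m" "x = (y + b i) / \<rho>"
      by (rule X_SucE[OF Suc.prems])
    have "x + 1 = (y + b i + \<rho>) / \<rho>"
      using rho_pos unfolding y(3) by (simp add: add_divide_distrib)
    also have "\<dots> \<le> (y + 1) / \<rho>"
      using b_bounds[OF y(2)] rho_pos by (intro divide_right_mono) auto
    also have "\<dots> \<le> 1 / \<rho> ^ n / \<rho>"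
      using Suc.IH[OF y(1)] rho_pos by (intro divide_right_mono) auto
    finally show ?case
      using Suc.IH[OF y(1)] b_bounds[OF y(2)] rho_pos y(3) by (simp add: mult.commute)
  qed auto
  then show "0 \<le> x" "x + 1 \<le> 1 / \<rho> ^ n" by auto
qed

lemma rightmost_in_X: "1 / \<rho> ^ n - 1 \<in> X n"
proof (induction n)
  case (Suc n)
  have "(1 / \<rho> ^ n - 1 + b m) / \<rho> = 1 / \<rho> ^ Suc n - 1"
    using rho_pos by (simp add: b_m diff_divide_distrib mult.commute)
  with X_SucI[OF Suc order_refl] show ?case by simp
qed auto

lemma X_cover:
  assumes "0 \<le> t" "t < 1 / \<rho> ^ n"
  shows "\<exists>x\<in>X n. x \<le> t \<and> t < x + 1"
  using assms
proof (induction n arbitrary: t)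
  case (Suc n)
  have "0 \<le> \<rho> * t" "\<rho> * t < 1 / \<rho> ^ n"
    using Suc.prems rho_pos by (auto simp: field_simps)
  from Suc.IH[OF this] obtain x where x: "x \<in> X n" "x \<le> \<rho> * t" "\<rho> * t < x + 1"
    by auto
  with digit_cover[of "\<rho> * t - x"] obtain i
    where i: "i \<le> m" "b i \<le> \<rho> * t - x" "\<rho> * t - x < b i + \<rho>"
    by auto
  show ?case
    using X_SucI[OF x(1) i(1)] i(2,3) rho_pos
    by (intro bexI[of _ "(x + b i) / \<rho>"]) (auto simp: field_simps)
qed auto

text \<open>Concatenation of words: \<open>v\<close> belongs to the first \<open>j\<close> letters
  and \<open>x\<close> to the last \<open>n\<close>.\<close>

lemma X_add:
  assumes "v \<in> X j" "x \<in> X n"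
  shows "v / \<rho> ^ n + x \<in> X (j + n)"
  using assms(2)
proof (induction n arbitrary: x)
  case (Suc n)
  obtain y i where y: "y \<in> X n" "i \<le> m" "x = (y + b i) / \<rho>"
    by (rule X_SucE[OF Suc.prems])
  have "v / \<rho> ^ Suc n + x = (v / \<rho> ^ n + y + b i) / \<rho>"
    using rho_pos unfolding y(3) by (simp add: field_simps)
  with X_SucI[OF Suc.IH[OF y(1)] y(2)] show ?case by simp
qed (use assms(1) in auto)

definition around :: "nat \<Rightarrow> real \<Rightarrow> real set" where
  "around n t = {x \<in> X n. x \<le> t \<and> t < x + 1}"

lemma finite_around: "finite (around n t)"
  using finite_X by (simp add: around_def)

text \<open>Words are split at their last letter, to match the recursion of \<open>X\<close>. By
  \<open>word_map_0\<close> that letter contributes \<open>\<rho> ^ n * b i\<close>.\<close>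

lemma X_eq_words:
  assumes "\<And>i x. i \<le> m \<Longrightarrow> \<phi> i x = \<rho> * x + b i"
  shows "X n = (\<lambda>I. word_map \<phi> I 0 / \<rho> ^ n) ` words m n"
proof (induction n)
  case 0
  have "words m 0 = {[]}" by (auto simp: words_def)
  then show ?case by (simp add: word_map_def)
next
  case (Suc n)
  have words: "words m (Suc n) = (\<lambda>(I, i). I @ [i]) ` (words m n \<times> {..m})"
  proof (intro equalityI subsetI)
    fix K assume "K \<in> words m (Suc n)"
    then show "K \<in> (\<lambda>(I, i). I @ [i]) ` (words m n \<times> {..m})"
      by (cases K rule: rev_cases) (auto simp: words_def)
  qed (auto simp: words_def)
  have snoc: "word_map \<phi> (I @ [i]) 0 / \<rho> ^ Suc n = (word_map \<phi> I 0 / \<rho> ^ n + b i) / \<rho>"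
    if "I \<in> words m n" "i \<le> m" for I i
  proof -
    have "I @ [i] \<in> words m (Suc n)" and len: "length I = n"
      using that by (auto simp: words_def)
    then have "word_map \<phi> (I @ [i]) 0 = word_map \<phi> I 0 + \<rho> ^ n * b i"
      using that by (simp add: word_map_0[OF assms] nth_append)
    then show ?thesis
      using rho_pos by (simp add: field_simps)
  qed
  show ?case
    unfolding words X.simps Suc
    by (force simp: image_iff snoc simp del: power_Suc)
qed

end

section \<open>Finiteness of differences under weak separation\<close>

locale separated_covering_digits = covering_digits +
  fixes c :: real
  assumes c_pos: "0 < c"
    and separated: "\<And>n x y. x \<in> X n \<Longrightarrow> y \<in> X n \<Longrightarrow> x \<noteq> y \<Longrightarrow> c \<le> \<bar>x - y\<bar>"
begin

lemma max_around_exists: "\<exists>N s. \<forall>n t. card (around n t) \<le> card (around N s)"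
proof -
  have "card (around n t) \<le> Suc (nat \<lfloor>1 / c\<rfloor>)" for n t
    using separated by (intro card_separated_le[OF c_pos, of _ t]) (force simp: around_def)+
  then have "\<exists>p. \<forall>q. card (case_prod around q) \<le> card (case_prod around p)"
    using ex_has_greatest_nat[of "\<lambda>_. True" "(0, 0)" "\<lambda>q. card (case_prod around q)"
        "Suc (Suc (nat \<lfloor>1 / c\<rfloor>))"]
    by (auto simp: less_Suc_eq_le le_SucI)
  then show ?thesis by auto
qed

lemma finite_nonneg_differences:
  "finite {d. \<exists>n. \<exists>x\<in>X n. \<exists>y\<in>X n. d = y - x \<and> 0 \<le> d \<and> d \<le> 1 - \<rho> ^ j}"
proof -
  obtain N s where max: "\<And>n t. card (around n t) \<le> card (around N s)"
    using max_around_exists by blast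
  \<comment> \<open>The maximum is at least 1, so \<open>s\<close> lies in some interval of level
    \<open>N\<close> and hence in the range that \<open>X_cover\<close> covers.\<close>
  have "around 0 0 = {0}" by (auto simp: around_def)
  with max[of 0 0] have "around N s \<noteq> {}" by auto
  then obtain a0 where "a0 \<in> X N" "a0 \<le> s" "s < a0 + 1"
    by (auto simp: around_def)
  with X_bounds[of a0 N] have s: "0 \<le> s" "s < 1 / \<rho> ^ N" by auto
  define v where "v = 1 / \<rho> ^ j - 1"
  \<comment> \<open>Translation is injective, so the translated set already has the maximal
    cardinality and leaves room for no further interval.\<close>
  have around_translate: "around (n + N) (w / \<rho> ^ N + s) = (\<lambda>a. w / \<rho> ^ N + a) ` around N s"
    if "w \<in> X n" for w n
  proof (rule card_seteq[OF finite_around, symmetric])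
    show "(\<lambda>a. w / \<rho> ^ N + a) ` around N s \<subseteq> around (n + N) (w / \<rho> ^ N + s)"
      using X_add[OF that] by (auto simp: around_def)
    show "card (around (n + N) (w / \<rho> ^ N + s)) \<le> card ((\<lambda>a. w / \<rho> ^ N + a) ` around N s)"
      using max by (simp add: card_image)
  qed
  let ?k = "j + N"
  have differences: "\<exists>a\<in>around N s. \<exists>u\<in>X ?k. y - x = \<rho> ^ ?k * (v / \<rho> ^ N + a - u)"
    if xy: "x \<in> X n" "y \<in> X n" and d: "0 \<le> y - x" "y - x \<le> 1 - \<rho> ^ j" for x y n
  proof -
    \<comment> \<open>The rightmost descendant of \<open>x\<close>, \<open>j\<close> levels down.
      The bounds on \<open>y - x\<close> say exactly that \<open>[w, w + 1)\<close> lies in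
      \<open>[y, y + 1)\<close> scaled by \<open>1 / \<rho> ^ j\<close>, so descendants of
      \<open>y\<close> cover the point \<open>w / \<rho> ^ N + s\<close>.\<close>
    define w where "w = x / \<rho> ^ j + v"
    have w: "w \<in> X (n + j)"
      unfolding w_def v_def by (intro X_add xy rightmost_in_X)
    have "y / \<rho> ^ j \<le> w"
      using d rho_pos by (simp add: w_def v_def field_simps)
    then have "y / \<rho> ^ ?k \<le> w / \<rho> ^ N"
      using rho_pos by (simp add: power_add field_simps)
    then have lower: "0 \<le> w / \<rho> ^ N + s - y / \<rho> ^ ?k"
      using s by simp
    have "w + 1 \<le> y / \<rho> ^ j + 1 / \<rho> ^ j"
      using d rho_pos by (simp add: w_def v_def field_simps)
    then have "w / \<rho> ^ N + 1 / \<rho> ^ N \<le> y / \<rho> ^ ?k + 1 / \<rho> ^ ?k"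
      using divide_right_mono[of "w + 1" "y / \<rho> ^ j + 1 / \<rho> ^ j" "\<rho> ^ N"] rho_pos
      by (simp add: power_add add_divide_distrib)
    then have "w / \<rho> ^ N + s - y / \<rho> ^ ?k < 1 / \<rho> ^ ?k"
      using s by linarith
    from X_cover[OF lower this] obtain u where u: "u \<in> X ?k"
      "u \<le> w / \<rho> ^ N + s - y / \<rho> ^ ?k" "w / \<rho> ^ N + s - y / \<rho> ^ ?k < u + 1"
      by blast
    have "y / \<rho> ^ ?k + u \<in> around (n + j + N) (w / \<rho> ^ N + s)"
      using u X_add[OF xy(2) u(1)] by (auto simp: around_def add.assoc)
    \<comment> \<open>Solving this equation for \<open>y - x\<close> leaves only \<open>a\<close>
      and \<open>u\<close>, which range over finite sets independent of \<open>n\<close>,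
      \<open>x\<close> and \<open>y\<close>.\<close>
    then obtain a where a: "a \<in> around N s" "y / \<rho> ^ ?k + u = w / \<rho> ^ N + a"
      unfolding around_translate[OF w] by auto
    have "(y - x) / \<rho> ^ ?k = v / \<rho> ^ N + a - u"
      using a(2) unfolding w_def by (simp add: power_add add_divide_distrib diff_divide_distrib)
    then have "y - x = \<rho> ^ ?k * (v / \<rho> ^ N + a - u)"
      using rho_pos by (metis nonzero_mult_div_cancel_left power_not_zero less_irrefl
          times_divide_eq_right)
    with a(1) u(1) show ?thesis by blast
  qed
  show ?thesis
  proof (rule finite_subset)
    show "{d. \<exists>n. \<exists>x\<in>X n. \<exists>y\<in>X n. d = y - x \<and> 0 \<le> d \<and> d \<le> 1 - \<rho> ^ j}
        \<subseteq> (\<lambda>(a, u). \<rho> ^ ?k * (v / \<rho> ^ N + a - u)) ` (around N s \<times> X ?k)" (is "_ \<subseteq> ?R")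
    proof
      fix d assume "d \<in> {d. \<exists>n. \<exists>x\<in>X n. \<exists>y\<in>X n. d = y - x \<and> 0 \<le> d \<and> d \<le> 1 - \<rho> ^ j}"
      then obtain n x y where "x \<in> X n" "y \<in> X n" "d = y - x" "0 \<le> y - x" "y - x \<le> 1 - \<rho> ^ j"
        by blast
      with differences[of x n y] obtain a u where
        "a \<in> around N s" "u \<in> X ?k" "d = \<rho> ^ ?k * (v / \<rho> ^ N + a - u)"
        by blast
      then show "d \<in> ?R"
        by (intro image_eqI[of _ _ "(a, u)"]) simp_all
    qed
  qed (simp add: finite_around finite_X)
qed

text \<open>The two-sided form serves the next lemma, where a parent difference may be
  negative.\<close>

lemma finite_differences:
  "finite {d. \<exists>n. \<exists>x\<in>X n. \<exists>y\<in>X n. d = y - x \<and> \<bar>d\<bar> \<le> 1 - \<rho> ^ j}" (is "finite ?D")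
proof -
  let ?P = "{d. \<exists>n. \<exists>x\<in>X n. \<exists>y\<in>X n. d = y - x \<and> 0 \<le> d \<and> d \<le> 1 - \<rho> ^ j}"
  have "?D \<subseteq> ?P \<union> uminus ` ?P"
  proof
    fix d assume "d \<in> ?D"
    then obtain n x y where "x \<in> X n" "y \<in> X n" "d = y - x" "\<bar>d\<bar> \<le> 1 - \<rho> ^ j"
      by blast
    then have "d \<in> ?P" if "0 \<le> d"
      using that by auto
    moreover have "- d \<in> ?P" if "\<not> 0 \<le> d"
    proof -
      have "- d = x - y" "0 \<le> - d" "- d \<le> 1 - \<rho> ^ j"
        using that \<open>d = y - x\<close> \<open>\<bar>d\<bar> \<le> 1 - \<rho> ^ j\<close> by auto
      then show ?thesis
        using \<open>x \<in> X n\<close> \<open>y \<in> X n\<close> by blast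
    qed
    ultimately show "d \<in> ?P \<union> uminus ` ?P"
      using image_eqI[of d uminus "- d" ?P] by (cases "0 \<le> d") simp_all
  qed
  then show ?thesis
    by (rule finite_subset) (intro finite_UnI finite_imageI finite_nonneg_differences)
qed

lemma differences_away_from_1:
  "\<exists>\<eta>>0. \<forall>n. \<forall>x\<in>X n. \<forall>y\<in>X n. y - x < 1 \<longrightarrow> y - x \<le> 1 - \<eta>"
proof -
  define E where "E = (\<lambda>(i, j). b i - b j) ` ({..m} \<times> {..m})"
  have "finite E" by (simp add: E_def)
  \<comment> \<open>The least possible digit difference is \<open>- (1 - \<rho>)\<close>; every
    other one exceeds it by at least \<open>\<delta>\<close>.\<close>
  obtain \<delta> where \<delta>: "0 < \<delta>" "\<And>e. e \<in> E \<Longrightarrow> 0 < 1 - \<rho> + e \<Longrightarrow> \<delta> \<le> 1 - \<rho> + e"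
    using finite_positive_lower_bound[of "(\<lambda>e. 1 - \<rho> + e) ` E"] \<open>finite E\<close> by auto
  \<comment> \<open>Being below \<open>\<delta>\<close> forces the least digit difference when the
    parent difference exceeds \<open>1 - \<rho> ^ j\<close>; being below \<open>\<rho>\<close> gives
    the lower bound for membership in \<open>F\<close>.\<close>
  obtain j where j: "\<rho> ^ j < min \<delta> \<rho>"
    using real_arch_pow_inv[of "min \<delta> \<rho>" \<rho>] \<delta>(1) rho_pos rho_less_1 by auto
  define F where "F = {d. \<exists>n. \<exists>x\<in>X n. \<exists>y\<in>X n. d = y - x \<and> \<bar>d\<bar> \<le> 1 - \<rho> ^ j}"
  have "finite F"
    unfolding F_def by (rule finite_differences)
  then have "finite ((\<lambda>(f, e). 1 - (f + e) / \<rho>) ` (F \<times> E))"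
    using \<open>finite E\<close> by simp
  from finite_positive_lower_bound[OF this] obtain \<eta>0 where \<eta>0: "0 < \<eta>0"
    "\<And>f e. f \<in> F \<Longrightarrow> e \<in> E \<Longrightarrow> 0 < 1 - (f + e) / \<rho> \<Longrightarrow> \<eta>0 \<le> 1 - (f + e) / \<rho>"
    by auto
  \<comment> \<open>The cap at 1 settles level 0 and all nonpositive differences.\<close>
  define \<eta> where "\<eta> = min 1 \<eta>0"
  have "0 < \<eta>" "\<eta> \<le> 1"
    using \<eta>0(1) by (auto simp: \<eta>_def)
  have "y - x \<le> 1 - \<eta>" if "x \<in> X n" "y \<in> X n" "y - x < 1" for n x y
    using that
  proof (induction n arbitrary: x y)
    case 0
    then show ?case using \<open>\<eta> \<le> 1\<close> by simp
  next
    case (Suc n)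
    obtain x' i where x': "x' \<in> X n" "i \<le> m" "x = (x' + b i) / \<rho>"
      by (rule X_SucE[OF Suc.prems(1)])
    obtain y' k where y': "y' \<in> X n" "k \<le> m" "y = (y' + b k) / \<rho>"
      by (rule X_SucE[OF Suc.prems(2)])
    define d' where "d' = y' - x'"
    define e where "e = b k - b i"
    have "e \<in> E"
      using x'(2) y'(2) by (force simp: E_def e_def)
    have e: "- (1 - \<rho>) \<le> e" "e \<le> 1 - \<rho>"
      using b_bounds[OF x'(2)] b_bounds[OF y'(2)] by (auto simp: e_def)
    have d: "y - x = (d' + e) / \<rho>"
      by (simp add: x' y' d'_def e_def diff_divide_distrib add_divide_distrib)
    then have less: "d' + e < \<rho>"
      using Suc.prems(3) rho_pos by simp
    show ?case
    proof (cases "y - x \<le> 0")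
      case True
      then show ?thesis using \<open>\<eta> \<le> 1\<close> by simp
    next
      case False
      then have "0 < d' + e"
        using rho_pos by (simp add: d divide_le_0_iff)
      show ?thesis
      proof (cases "d' \<le> 1 - \<rho> ^ j")
        case True
        moreover have "- (1 - \<rho> ^ j) \<le> d'"
          using \<open>0 < d' + e\<close> e j by auto
        ultimately have "d' \<in> F"
          unfolding F_def using x'(1) y'(1) by (auto simp: d'_def)
        from \<eta>0(2)[OF this \<open>e \<in> E\<close>] show ?thesis
          using Suc.prems(3) by (simp add: d \<eta>_def)
      next
        case False
        then have "1 - \<rho> + e < \<delta>"
          using less j by linarith
        then have "e = - (1 - \<rho>)"
          using \<delta>(2)[OF \<open>e \<in> E\<close>] e by linarith
        have "d' \<le> 1 - \<eta>"
          using Suc.IH[OF x'(1) y'(1)] less e unfolding d'_def by linarith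
        \<comment> \<open>For this \<open>e\<close>, \<open>1 - (y - x) = (1 - d') / \<rho>\<close>:
          the distance to 1 only grows from parent to child, so the bound \<open>\<eta>\<close> is
          inherited.\<close>
        have "\<eta> * \<rho> \<le> \<eta>"
          using \<open>0 < \<eta>\<close> rho_less_1 by simp
        then have "d' + e \<le> (1 - \<eta>) * \<rho>"
          using \<open>d' \<le> 1 - \<eta>\<close> \<open>e = - (1 - \<rho>)\<close> by (simp add: algebra_simps)
        then show ?thesis
          using rho_pos by (simp add: d pos_divide_le_eq)
      qed
    qed
  qed
  with \<open>0 < \<eta>\<close> show ?thesis by blast
qed

lemma finite_differences_less_1:
  "finite {d. \<exists>n. \<exists>x\<in>X n. \<exists>y\<in>X n. d = \<bar>x - y\<bar> \<and> d < 1}"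
proof -
  obtain \<eta> where \<eta>: "0 < \<eta>"
    "\<And>n x y. x \<in> X n \<Longrightarrow> y \<in> X n \<Longrightarrow> y - x < 1 \<Longrightarrow> y - x \<le> 1 - \<eta>"
    using differences_away_from_1 by blast
  \<comment> \<open>With this \<open>j\<close>, every difference of absolute value below 1 falls in
    the range of \<open>finite_differences\<close>.\<close>
  obtain j where j: "\<rho> ^ j < \<eta>"
    using real_arch_pow_inv[OF \<eta>(1) rho_less_1] by blast
  let ?D = "{d. \<exists>n. \<exists>x\<in>X n. \<exists>y\<in>X n. d = y - x \<and> \<bar>d\<bar> \<le> 1 - \<rho> ^ j}"
  have "\<bar>x - y\<bar> \<in> abs ` ?D" if "x \<in> X n" "y \<in> X n" "\<bar>x - y\<bar> < 1" for n x y
  proof (rule image_eqI)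
    show "\<bar>x - y\<bar> = \<bar>y - x\<bar>" by (rule abs_minus_commute)
    have "\<bar>y - x\<bar> \<le> 1 - \<rho> ^ j"
      using \<eta>(2)[OF that(1,2)] \<eta>(2)[OF that(2,1)] that(3) j by linarith
    then show "y - x \<in> ?D"
      using that(1,2) by blast
  qed
  then have "{d. \<exists>n. \<exists>x\<in>X n. \<exists>y\<in>X n. d = \<bar>x - y\<bar> \<and> d < 1} \<subseteq> abs ` ?D"
    by blast
  then show ?thesis
    by (rule finite_subset) (intro finite_imageI finite_differences)
qed

end

section \<open>Translation back to words\<close>

theorem theorem1p9:
  fixes m :: nat and \<rho> :: real and b :: "nat \<Rightarrow> real" and \<phi> :: "nat \<Rightarrow> real \<Rightarrow> real"
  assumes "m \<ge> 1"
    and "0 < \<rho>" and "\<rho> < 1"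
    and "\<And>i x. i \<le> m \<Longrightarrow> \<phi> i x = \<rho> * x + b i"
    and "b 0 = 0" and "\<And>i. i < m \<Longrightarrow> b i < b (Suc i)" and "b m = 1 - \<rho>"
    and "\<And>i. i < m \<Longrightarrow> b (Suc i) - b i \<le> \<rho>"
    and "weak_separation_condition m \<rho> \<phi>"
  shows "finite_type_condition m \<rho> \<phi>"
proof -
  interpret covering_digits m \<rho> b
    using assms by unfold_locales auto
  have X: "X n = (\<lambda>I. word_map \<phi> I 0 / \<rho> ^ n) ` words m n" for n
    using assms(4) by (rule X_eq_words)
  have scale: "\<bar>p - q\<bar> / \<rho> ^ n = \<bar>p / \<rho> ^ n - q / \<rho> ^ n\<bar>" for p q n
    using \<open>0 < \<rho>\<close> by (simp flip: diff_divide_distrib)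
  obtain c where c: "0 < c" "\<And>n I J. I \<in> words m n \<Longrightarrow> J \<in> words m n \<Longrightarrow>
      \<bar>word_map \<phi> I 0 / \<rho> ^ n - word_map \<phi> J 0 / \<rho> ^ n\<bar> = 0 \<or>
      c \<le> \<bar>word_map \<phi> I 0 / \<rho> ^ n - word_map \<phi> J 0 / \<rho> ^ n\<bar>"
    using assms(9) unfolding weak_separation_condition_def scale by blast
  interpret separated_covering_digits m \<rho> b c
  proof unfold_locales
    show "0 < c" by fact
    show "c \<le> \<bar>x - y\<bar>" if "x \<in> X n" "y \<in> X n" "x \<noteq> y" for n x y
      using that c(2) unfolding X by fastforce
  qed
  \<comment> \<open>The set of all differences below 1 serves as \<open>\<Gamma>\<close>; only its
    finiteness needs the work above.\<close>
  let ?G = "{d. \<exists>n. \<exists>x\<in>X n. \<exists>y\<in>X n. d = \<bar>x - y\<bar> \<and> d < 1}"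
  have "?G \<subseteq> {0..<1}" by auto
  moreover have "\<bar>word_map \<phi> I 0 / \<rho> ^ n - word_map \<phi> J 0 / \<rho> ^ n\<bar> \<ge> 1 \<or>
      \<bar>word_map \<phi> I 0 / \<rho> ^ n - word_map \<phi> J 0 / \<rho> ^ n\<bar> \<in> ?G"
    if "I \<in> words m n" "J \<in> words m n" for n I J
  proof -
    have "word_map \<phi> I 0 / \<rho> ^ n \<in> X n" "word_map \<phi> J 0 / \<rho> ^ n \<in> X n"
      using that by (auto simp: X)
    then show ?thesis using not_le by blast
  qed
  ultimately show ?thesis
    unfolding finite_type_condition_def scale
    by (intro exI[of _ ?G] conjI finite_differences_less_1) auto
qed

end
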